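(* Let $G$ be a simple connected undirected graph with $n\ge 2$ vertices. Then $$-\sqrt{\frac{n-2}{2n}\,S_D(G)}\;<\;\delta_{D^G}\;\le\;\sqrt{\frac{n}{n-1}\,S_D(G)}.$$
   Context: For a connected graph $G$ with vertices $v_1,\dots,v_n$, the distance matrix $D(G)$ is the $n\times n$ symmetric matrix whose $(i,j)$ entry is the shortest-path distance $d_G(v_i,v_j)$. The distance eigenvalues of $G$ are the eigenvalues $\rho_1\ge\cdots\ge\rho_n$ of $D(G)$, listed with multiplicity. $S_D(G)=\sum_{i=1}^n\rho_i^2=\sum_{i=1}^n\sum_{j=1}^n d_G(v_i,v_j)^2$. The distance spectral gap of $G$ is $\delta_{D^G}=\rho_1-\rho_2$. *)

theory Defs
  imports
    Graph_Theory.Graph_Theory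
    Jordan_Normal_Form.Char_Poly
    "HOL-Computational_Algebra.Computational_Algebra"
begin

text \<open>
  An undirected edge of \<open>G\<close> is a pair of opposite arcs, so giving every arc weight 1
  makes the library's \<open>\<mu>\<close> the length of a shortest path. It has values in
  \<open>ereal\<close> and is finite for connected \<open>G\<close>.
\<close>

definition graph_dist :: "('a, 'b) pre_digraph \<Rightarrow> 'a \<Rightarrow> 'a \<Rightarrow> real" where
  "graph_dist G u v = real_of_ereal (wf_digraph.\<mu> G (\<lambda>_. 1) u v)"

text \<open>
  The list \<open>vs\<close> enumerates the vertices $v_1,\dots,v_n$ without repetition.
\<close>

definition distance_matrix :: "('a, 'b) pre_digraph \<Rightarrow> 'a list \<Rightarrow> real mat" where
  "distance_matrix G vs =
     mat (length vs) (length vs) (\<lambda>(i, j). graph_dist G (vs ! i) (vs ! j))"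

text \<open>
  Eigenvalues in decreasing order, repeated according to their multiplicity as roots of
  the characteristic polynomial. For a real symmetric matrix all complex roots are real,
  so the list has length \<open>n\<close>. Lists are indexed from 0: $\rho_i$ is the entry at
  \<open>i - 1\<close>.
\<close>

definition distance_eigenvalues :: "('a, 'b) pre_digraph \<Rightarrow> 'a list \<Rightarrow> real list" where
  "distance_eigenvalues G vs =
     rev (sorted_list_of_multiset (proots (char_poly (distance_matrix G vs))))"

definition S_D :: "('a, 'b) pre_digraph \<Rightarrow> 'a list \<Rightarrow> real" where
  "S_D G vs = (\<Sum>\<rho>\<leftarrow>distance_eigenvalues G vs. \<rho>\<^sup>2)"

definition distance_spectral_gap :: "('a, 'b) pre_digraph \<Rightarrow> 'a list \<Rightarrow> real" where
  "distance_spectral_gap G vs = distance_eigenvalues G vs ! 0 - distance_eigenvalues G vs ! 1"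

end

theory Submission
  imports Defs "Jordan_Normal_Form.Schur_Decomposition"
begin

text \<open>
  The distance matrix \<open>D\<close> is real and symmetric with zero diagonal, so its characteristic
  polynomial splits over the reals (\<open>char_poly_real_symmetric_mat_splits\<close>), and by the Schur
  decomposition (\<open>trace_mat_power_eq_sum_eigenvalues\<close>) its \<open>n\<close> eigenvalues satisfy
  \<open>\<Sum>\<rho>\<^sub>i = tr D = 0\<close> and \<open>\<Sum>\<rho>\<^sub>i\<^sup>2 = tr (D\<^sup>2) = \<Sum>d(u, v)\<^sup>2 > 0\<close>. Both bounds follow from these two
  facts alone (\<open>gap_bounds_sum_zero\<close>).

  For the upper bound, \<open>\<rho>\<^sub>2\<close> is at least the average \<open>- \<rho>\<^sub>1 / (n - 1)\<close> of all eigenvalues but the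
  first, so the gap is at most \<open>\<rho>\<^sub>1 n / (n - 1)\<close>. The Cauchy-Schwarz inequality for the same
  \<open>n - 1\<close> eigenvalues, whose sum is \<open>- \<rho>\<^sub>1\<close>, gives \<open>\<rho>\<^sub>1\<^sup>2 \<le> (n - 1) (S - \<rho>\<^sub>1\<^sup>2)\<close> for the sum \<open>S\<close>
  of the squares, that is \<open>\<rho>\<^sub>1\<^sup>2 n / (n - 1) \<le> S\<close>. Combining the two yields the claim.

  For the lower bound, the gap is nonnegative because the eigenvalues are in decreasing order,
  and for \<open>n > 2\<close> the bound is negative because \<open>S > 0\<close>. For \<open>n = 2\<close> the bound is zero, and the
  eigenvalues are \<open>\<rho>\<^sub>1\<close> and \<open>- \<rho>\<^sub>1\<close> with \<open>\<rho>\<^sub>1 > 0\<close>.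
\<close>

section \<open>Trace and eigenvalues\<close>

definition trace_mat :: "'a :: comm_monoid_add mat \<Rightarrow> 'a" where
  "trace_mat A = sum_list (diag_mat A)"

lemma trace_mat_eq_sum: "trace_mat A = (\<Sum>i<dim_row A. A $$ (i, i))"
  by (simp add: trace_mat_def diag_mat_def sum_list_sum_nth atLeast0LessThan)

lemma trace_mat_mult:
  fixes A B :: "'a :: comm_semiring_0 mat"
  assumes "A \<in> carrier_mat n m" "B \<in> carrier_mat m n"
  shows "trace_mat (A * B) = (\<Sum>i<n. \<Sum>j<m. A $$ (i, j) * B $$ (j, i))"
  using assms by (auto simp: trace_mat_eq_sum scalar_prod_def atLeast0LessThan)

lemma trace_mat_mult_commute:
  fixes A B :: "'a :: comm_semiring_0 mat"
  assumes "A \<in> carrier_mat n m" "B \<in> carrier_mat m n"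
  shows "trace_mat (A * B) = trace_mat (B * A)"
  unfolding trace_mat_mult[OF assms] trace_mat_mult[OF assms(2,1)]
  by (subst sum.swap) (simp add: mult.commute)

text \<open>
  With \<open>A = P B Q\<close>, moving \<open>Q\<close> to the front under the trace cancels it against \<open>P\<close>.
\<close>

lemma trace_mat_similar:
  fixes A B :: "'a :: comm_semiring_1 mat"
  assumes "similar_mat A B"
  shows "trace_mat A = trace_mat B"
proof -
  from similar_matD[OF assms] obtain n P Q where
    c: "A \<in> carrier_mat n n" "B \<in> carrier_mat n n" "P \<in> carrier_mat n n" "Q \<in> carrier_mat n n"
    and QP: "Q * P = 1\<^sub>m n" and A: "A = P * B * Q"
    by auto
  have "trace_mat A = trace_mat (Q * (P * B))"
    unfolding A using c by (intro trace_mat_mult_commute) auto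
  also have "Q * (P * B) = B"
    using c QP by (simp add: assoc_mult_mat[symmetric, of Q n n P n B n])
  finally show ?thesis .
qed

text \<open>
  By the Schur decomposition, \<open>A\<close> is similar to an upper triangular matrix \<open>B\<close> with the
  eigenvalues on its diagonal. In the trace of \<open>B\<^sup>2\<close> every product \<open>B\<^sub>i\<^sub>j B\<^sub>j\<^sub>i\<close> with \<open>i \<noteq> j\<close>
  contains an entry below the diagonal, so only the squares of the diagonal remain.
\<close>

lemma trace_mat_power_eq_sum_eigenvalues:
  fixes A :: "'a :: conjugatable_ordered_field mat"
  assumes A: "A \<in> carrier_mat n n" and split: "char_poly A = (\<Prod>e\<leftarrow>es. [:- e, 1:])"
  shows "trace_mat A = sum_list es" and "trace_mat (A * A) = (\<Sum>e\<leftarrow>es. e\<^sup>2)"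
proof -
  obtain B P Q where "schur_decomposition A es = (B, P, Q)"
    by (metis prod_cases3)
  from schur_decomposition[OF A split this]
  have wit: "similar_mat_wit A B P Q" and tri: "upper_triangular B" and diag: "diag_mat B = es"
    by auto
  have B: "B \<in> carrier_mat n n"
    using similar_mat_witD2[OF A wit] by simp
  have sim: "similar_mat A B"
    using wit by (auto simp: similar_mat_def)
  show "trace_mat A = sum_list es"
    using trace_mat_similar[OF sim] diag by (simp add: trace_mat_def)
  have "similar_mat (A ^\<^sub>m 2) (B ^\<^sub>m 2)"
    using similar_mat_wit_pow[OF wit] by (auto simp: similar_mat_def)
  then have "trace_mat (A * A) = trace_mat (B * B)"
    using A B by (auto simp: numeral_2_eq_2 dest: trace_mat_similar)
  also have "\<dots> = (\<Sum>i<n. \<Sum>j<n. B $$ (i, j) * B $$ (j, i))"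
    by (rule trace_mat_mult[OF B B])
  also have "\<dots> = (\<Sum>i<n. \<Sum>j<n. if j = i then (B $$ (i, i))\<^sup>2 else 0)"
  proof (intro sum.cong refl)
    fix i j assume "i \<in> {..<n}" "j \<in> {..<n}"
    then show "B $$ (i, j) * B $$ (j, i) = (if j = i then (B $$ (i, i))\<^sup>2 else 0)"
      using upper_triangularD[OF tri, of i j] upper_triangularD[OF tri, of j i] B
      by (cases i j rule: linorder_cases) (auto simp: power2_eq_square)
  qed
  also have "\<dots> = (\<Sum>i<n. (B $$ (i, i))\<^sup>2)"
    by simp
  also have "\<dots> = (\<Sum>e\<leftarrow>es. e\<^sup>2)"
    unfolding diag[symmetric] using B
    by (simp add: diag_mat_def sum_list_sum_nth atLeast0LessThan o_def)
  finally show "trace_mat (A * A) = (\<Sum>e\<leftarrow>es. e\<^sup>2)" .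
qed

text \<open>
  For an eigenvector \<open>v\<close>, evaluating the Hermitian form \<open>v\<^sup>* A v\<close> with \<open>A\<close> acting on either side
  gives both \<open>k |v|\<^sup>2\<close> and \<open>cnj k |v|\<^sup>2\<close>.
\<close>

lemma eigenvalue_real_symmetric_mat:
  fixes A :: "real mat"
  assumes A: "A \<in> carrier_mat n n" and sym: "transpose_mat A = A"
    and ev: "eigenvalue (map_mat complex_of_real A) k"
  shows "k \<in> \<real>"
proof -
  let ?C = "map_mat complex_of_real A"
  have C: "?C \<in> carrier_mat n n" using A by simp
  have symC: "transpose_mat ?C = ?C"
    by (metis sym map_mat_transpose)
  from ev obtain v where v: "v \<in> carrier_vec n" "v \<noteq> 0\<^sub>v n" and eq: "?C *\<^sub>v v = k \<cdot>\<^sub>v v"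
    using C by (auto simp: eigenvalue_def eigenvector_def)
  have w: "conjugate v \<in> carrier_vec n" using v by simp
  have conj: "?C *\<^sub>v conjugate v = conjugate (?C *\<^sub>v v)"
    using A v by (intro eq_vecI) (auto simp: scalar_prod_def)
  have "k * (v \<bullet>c v) = (?C *\<^sub>v v) \<bullet>c v"
    using eq v w by simp
  also have "\<dots> = (transpose_mat ?C *\<^sub>v v) \<bullet>c v"
    by (simp only: symC)
  also have "\<dots> = v \<bullet> (?C *\<^sub>v conjugate v)"
    by (rule transpose_vec_mult_scalar[OF C w v(1)])
  also have "\<dots> = v \<bullet> (cnj k \<cdot>\<^sub>v conjugate v)"
    by (simp only: conj eq conjugate_smult_vec) simp
  also have "\<dots> = cnj k * (v \<bullet>c v)"
    using v w by simp
  finally have "k = cnj k"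
    using v by simp
  then show ?thesis
    by (simp add: Reals_cnj_iff)
qed

text \<open>
  The polynomial splits over the complex numbers, where all its roots are real; since the
  embedding of real into complex polynomials is injective, the factorization descends.
\<close>

lemma char_poly_real_symmetric_mat_splits:
  fixes A :: "real mat"
  assumes A: "A \<in> carrier_mat n n" and sym: "transpose_mat A = A"
  obtains es where "char_poly A = (\<Prod>e\<leftarrow>es. [:- e, 1:])" and "length es = n"
proof -
  let ?C = "map_mat complex_of_real A"
  have C: "?C \<in> carrier_mat n n" using A by simp
  obtain as where as: "char_poly ?C = (\<Prod>a\<leftarrow>as. [:- a, 1:])" and len: "length as = n"
    using char_poly_factorized[OF C] by auto
  have real: "a \<in> \<real>" if "a \<in> set as" for a
  proof (rule eigenvalue_real_symmetric_mat[OF A sym])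
    have "poly (char_poly ?C) a = 0"
      unfolding as using that by (auto simp: poly_prod_list prod_list_zero_iff o_def)
    then show "eigenvalue ?C a"
      using eigenvalue_root_char_poly[OF C] by simp
  qed
  define es where "es = map Re as"
  have as_es: "as = map complex_of_real es"
    using real by (auto simp: es_def o_def intro!: map_idI[symmetric])
  interpret R: map_poly_inj_idom_hom complex_of_real ..
  have "map_poly complex_of_real (char_poly A) = char_poly ?C"
    by (rule of_real_hom.char_poly_hom[OF A, symmetric])
  also have "\<dots> = map_poly complex_of_real (\<Prod>e\<leftarrow>es. [:- e, 1:])"
    unfolding as as_es by (simp add: R.hom_prod_list o_def)
  finally have "char_poly A = (\<Prod>e\<leftarrow>es. [:- e, 1:])"
    by simp
  moreover have "length es = n"
    using len by (simp add: es_def)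
  ultimately show ?thesis
    by (rule that)
qed

section \<open>Graph distance\<close>

lemma (in wf_digraph) awalk_cost_one: "awalk_cost (\<lambda>_. 1) p = real (length p)"
  by (induction p) auto

lemma (in sym_digraph) awalk_reverse:
  assumes "awalk u p v"
  shows "\<exists>q. awalk v q u \<and> length q = length p"
  using assms
proof (induction p arbitrary: u)
  case Nil
  then show ?case by (auto simp: awalk_Nil_iff)
next
  case (Cons e p)
  then obtain q where q: "awalk v q (head G e)" "length q = length p"
    by (auto simp: awalk_Cons_iff)
  have e: "e \<in> arcs G" "u = tail G e"
    using Cons.prems by (auto simp: awalk_Cons_iff)
  obtain e' where "e' \<in> arcs G" "tail G e' = head G e" "head G e' = tail G e"
    using sym_arcs e unfolding symmetric_conv by metis
  then have "awalk (head G e) [e'] u"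
    using e arc_implies_awalk by metis
  then have "awalk v (q @ [e']) u"
    using q by (auto intro: awalk_appendI)
  then show ?case
    using q by (intro exI[of _ "q @ [e']"]) simp
qed

text \<open>
  With unit weights, the distance depends only on the set of lengths of walks between the two
  vertices, and reversing walks preserves their lengths.
\<close>

lemma (in sym_digraph) graph_dist_commute: "graph_dist G u v = graph_dist G v u"
proof -
  have *: "(\<lambda>p. ereal (real (length p))) ` {p. awalk x p y} =
      (\<lambda>k. ereal (real k)) ` {k. \<exists>p. awalk x p y \<and> length p = k}" for x y
    by auto
  have "{k. \<exists>p. awalk u p v \<and> length p = k} = {k. \<exists>p. awalk v p u \<and> length p = k}"
    using awalk_reverse by metis
  then show ?thesis
    by (simp add: graph_dist_def \<mu>_def awalk_cost_one *)
qed

lemma (in wf_digraph) graph_dist_self: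
  assumes "u \<in> verts G"
  shows "graph_dist G u u = 0"
proof -
  have "\<mu> (\<lambda>_. 1) u u = 0"
    unfolding \<mu>_def using assms
    by (intro antisym INF_greatest INF_lower2[of "[]"])
       (auto simp: awalk_Nil_iff awalk_cost_one)
  then show ?thesis by (simp add: graph_dist_def)
qed

text \<open>
  Reachability matters because the distance between unreachable vertices is \<open>\<infinity>\<close> as an extended
  real, which becomes 0 as a real number.
\<close>

lemma (in wf_digraph) graph_dist_ge_1:
  assumes "u \<rightarrow>\<^sup>* v" and "u \<noteq> v"
  shows "graph_dist G u v \<ge> 1"
proof -
  obtain p where p: "awalk u p v"
    using assms by (auto simp: reachable_awalk)
  have "\<mu> (\<lambda>_. 1) u v \<ge> 1"
    unfolding \<mu>_def
  proof (rule INF_greatest)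
    fix q assume "q \<in> {q. awalk u q v}"
    then have "q \<noteq> []"
      using assms by (auto simp: awalk_Nil_iff)
    then show "1 \<le> ereal (awalk_cost (\<lambda>_. 1) q)"
      by (cases q) (auto simp: awalk_cost_one)
  qed
  moreover have "\<mu> (\<lambda>_. 1) u v \<le> ereal (awalk_cost (\<lambda>_. 1) p)"
    by (rule min_cost_le_walk_cost[OF p])
  ultimately show ?thesis
    by (cases "\<mu> (\<lambda>_. 1) u v") (auto simp: graph_dist_def)
qed

section \<open>Gap between the two largest of finitely many reals with sum zero\<close>

lemma sum_list_squares_shift:
  fixes xs :: "real list"
  shows "(\<Sum>x\<leftarrow>xs. (x + c)\<^sup>2) = (\<Sum>x\<leftarrow>xs. x\<^sup>2) + 2 * c * sum_list xs + real (length xs) * c\<^sup>2"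
  by (induction xs) (auto simp: power2_eq_square algebra_simps)

lemma sum_list_le_length_times:
  fixes xs :: "real list"
  assumes "\<And>x. x \<in> set xs \<Longrightarrow> x \<le> b"
  shows "sum_list xs \<le> real (length xs) * b"
  using assms by (induction xs) (auto simp: algebra_simps intro: add_mono)

text \<open>
  The upper bound is attained by \<open>(n - 1, -1, \<dots>, -1)\<close>, the spectrum of the complete graph, where
  both the average bound on the second entry and the Cauchy-Schwarz inequality are equalities.
\<close>

lemma gap_bounds_sum_zero:
  fixes r :: "real list"
  assumes sorted: "sorted (rev r)" and len: "length r = n" "n \<ge> 2"
    and sum0: "sum_list r = 0" and pos: "(\<Sum>x\<leftarrow>r. x\<^sup>2) > 0"
  defines "S \<equiv> (\<Sum>x\<leftarrow>r. x\<^sup>2)"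
  shows "- sqrt ((real n - 2) / (2 * real n) * S) < r ! 0 - r ! 1"
    and "r ! 0 - r ! 1 \<le> sqrt (real n / (real n - 1) * S)"
proof -
  obtain a b ys where r: "r = a # b # ys"
    using len by (cases r; cases "tl r") auto
  have ab: "b \<le> a" and ys: "\<And>y. y \<in> set ys \<Longrightarrow> y \<le> b"
    using sorted unfolding r by (auto simp: sorted_append)
  define m where "m = real n - 1"
  have m: "m \<ge> 1" "real n = m + 1" "real (length ys) = m - 1"
    using len unfolding m_def r by auto
  have S: "S = a\<^sup>2 + (\<Sum>x\<leftarrow>b # ys. x\<^sup>2)" "S > 0"
    using pos by (auto simp: S_def r)
  have tail: "sum_list (b # ys) = - a"
    using sum0 by (simp add: r)
  show "- sqrt ((real n - 2) / (2 * real n) * S) < r ! 0 - r ! 1"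
  proof (cases "n = 2")
    case True
    then have "ys = []" using len by (simp add: r)
    then have "b = - a" "a \<noteq> 0"
      using tail S by auto
    then show ?thesis
      using True ab by (simp add: r)
  next
    case False
    then have "(real n - 2) / (2 * real n) * S > 0"
      using len S by simp
    then have "sqrt ((real n - 2) / (2 * real n) * S) > 0"
      by (simp only: real_sqrt_gt_0_iff)
    moreover have "r ! 0 - r ! 1 \<ge> 0"
      using ab by (simp add: r)
    ultimately show ?thesis
      by linarith
  qed
  have "- a \<le> m * b"
    using sum_list_le_length_times[of ys b, OF ys] tail m by (simp add: algebra_simps)
  then have gap: "a - b \<le> a * (m + 1) / m"
    using m by (simp add: field_simps)
  \<comment> \<open>Cauchy-Schwarz for the tail, as nonnegativity of its squared deviations from its mean \<open>- a / m\<close>.\<close>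
  have "0 \<le> (\<Sum>x\<leftarrow>b # ys. (x + a / m)\<^sup>2)"
    by (rule sum_list_nonneg) auto
  also have "\<dots> = S - a\<^sup>2 + 2 * (a / m) * (- a) + m * (a / m)\<^sup>2"
    unfolding sum_list_squares_shift tail using S m by simp
  also have "\<dots> = S - a\<^sup>2 * (m + 1) / m"
    using m by (simp add: field_simps power2_eq_square)
  finally have "(m + 1) / m * (a\<^sup>2 * (m + 1) / m) \<le> (m + 1) / m * S"
    using m by (intro mult_left_mono) auto
  then have "(a * (m + 1) / m)\<^sup>2 \<le> (m + 1) / m * S"
    by (simp add: power2_eq_square mult_ac)
  then have "a * (m + 1) / m \<le> sqrt ((m + 1) / m * S)"
    by (rule real_le_rsqrt)
  then show "r ! 0 - r ! 1 \<le> sqrt (real n / (real n - 1) * S)"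
    using gap m by (simp add: r)
qed

section \<open>The distance spectral gap\<close>

theorem proposition2p2:
  fixes G :: "('a, 'b) pre_digraph" and vs :: "'a list" and n :: nat
  assumes "graph G" and "Digraph_Component.connected G"
    and "set vs = verts G" and "distinct vs"
    and "n = card (verts G)" and "n \<ge> 2"
  shows "- sqrt ((real n - 2) / (2 * real n) * S_D G vs) < distance_spectral_gap G vs \<and>
         distance_spectral_gap G vs \<le> sqrt (real n / (real n - 1) * S_D G vs)"
proof -
  interpret graph G by fact
  have n: "length vs = n"
    using assms distinct_card by metis
  let ?D = "distance_matrix G vs"
  have D: "?D \<in> carrier_mat n n"
    by (simp add: distance_matrix_def n)
  have entry: "?D $$ (i, j) = graph_dist G (vs ! i) (vs ! j)" if "i < n" "j < n" for i j
    using that by (simp add: distance_matrix_def n)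
  have D_commute: "?D $$ (i, j) = ?D $$ (j, i)" if "i < n" "j < n" for i j
    using that graph_dist_commute by (simp add: entry)
  have sym: "transpose_mat ?D = ?D"
    using D D_commute by (intro eq_matI) auto
  obtain es where es: "char_poly ?D = (\<Prod>e\<leftarrow>es. [:- e, 1:])" "length es = n"
    by (rule char_poly_real_symmetric_mat_splits[OF D sym])
  have proots: "proots (\<Prod>e\<leftarrow>xs. [:- e, 1:]) = mset xs" for xs :: "real list"
  proof (induction xs)
    case (Cons x xs)
    have "(\<Prod>e\<leftarrow>xs. [:- e, 1:]) \<noteq> 0"
      by (auto simp: prod_list_zero_iff)
    then have "proots ([:- x, 1:] * (\<Prod>e\<leftarrow>xs. [:- e, 1:])) =
        proots [:- x, 1:] + proots (\<Prod>e\<leftarrow>xs. [:- e, 1:])"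
      by (intro proots_mult) auto
    also have "\<dots> = {#x#} + mset xs"
      using Cons.IH by (simp only: proots_linear_factor minus_minus)
    finally show ?case
      by (simp only: list.map prod_list.Cons mset.simps add_mset_add_single[of x "mset xs"] union_commute)
  qed simp
  let ?r = "distance_eigenvalues G vs"
  have mset_r: "mset ?r = mset es"
    by (simp add: distance_eigenvalues_def es proots)
  have sum_r: "sum_list (map f ?r) = sum_list (map f es)" for f :: "real \<Rightarrow> real"
    by (metis mset_r mset_map sum_mset_sum_list)
  have "sum_list ?r = trace_mat ?D"
    using sum_r[of "\<lambda>x. x"] trace_mat_power_eq_sum_eigenvalues(1)[OF D es(1)] by simp
  also have "\<dots> = 0"
    unfolding trace_mat_eq_sum
  proof (intro sum.neutral ballI)
    fix i assume "i \<in> {..<dim_row ?D}"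
    then have i: "i < n" using D by simp
    then have "vs ! i \<in> verts G"
      using n assms(3) nth_mem by metis
    then show "?D $$ (i, i) = 0"
      by (simp add: entry[OF i i] graph_dist_self)
  qed
  finally have sum0: "sum_list ?r = 0" .
  \<comment> \<open>One nonzero entry of \<open>D\<close> makes its sum of squared entries, the trace of \<open>D\<^sup>2\<close>, positive.\<close>
  have "0 < (?D $$ (0, 1))\<^sup>2"
  proof -
    have "vs ! 0 \<in> verts G" "vs ! 1 \<in> verts G" "vs ! 0 \<noteq> vs ! 1"
      using assms n by (auto simp flip: assms(3) simp: nth_eq_iff_index_eq)
    moreover have "strongly_connected G"
      using symmetric_connected_imp_strongly_connected sym_arcs assms by blast
    ultimately have "graph_dist G (vs ! 0) (vs ! 1) \<ge> 1"
      by (intro graph_dist_ge_1) auto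
    then show ?thesis
      using assms by (simp add: entry)
  qed
  also have "\<dots> \<le> (\<Sum>j<n. (?D $$ (0, j))\<^sup>2)"
    using assms by (intro member_le_sum) auto
  also have "\<dots> \<le> (\<Sum>i<n. \<Sum>j<n. (?D $$ (i, j))\<^sup>2)"
    using assms by (intro member_le_sum[where f = "\<lambda>i. \<Sum>j<n. (?D $$ (i, j))\<^sup>2"]) (auto intro: sum_nonneg)
  also have "\<dots> = trace_mat (?D * ?D)"
    unfolding trace_mat_mult[OF D D]
    by (intro sum.cong refl) (auto simp: power2_eq_square D_commute)
  also have "\<dots> = (\<Sum>x\<leftarrow>?r. x\<^sup>2)"
    using trace_mat_power_eq_sum_eigenvalues(2)[OF D es(1)] sum_r by simp
  finally have pos: "(\<Sum>x\<leftarrow>?r. x\<^sup>2) > 0" .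
  have "sorted (rev ?r)" "length ?r = n"
    using es(2) mset_r by (auto simp: distance_eigenvalues_def dest: mset_eq_length)
  from gap_bounds_sum_zero[OF this assms(6) sum0 pos] show ?thesis
    by (simp add: S_D_def distance_spectral_gap_def)
qed

end
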